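(* There exists no polynomial that is a $(\mathrm{tw},\omega)$-binding function for all polynomially $(\mathrm{tw},\omega)$-bounded graph classes.
   Context: All graphs are finite, simple and undirected. $\mathrm{tw}(G)$ is the treewidth and $\omega(G)$ the clique number of $G$. A function $f$ is a $(\mathrm{tw},\omega)$-binding function for a graph class $\mathcal{G}$ if for every $G\in\mathcal{G}$ and every induced subgraph $G'$ of $G$, $\mathrm{tw}(G')\le f(\omega(G'))$. A graph class is polynomially $(\mathrm{tw},\omega)$-bounded if it has a $(\mathrm{tw},\omega)$-binding function that is a polynomial. *)

theory Defs
  imports
    "Graph_Theory.Graph_Theory"
    "HOL-Computational_Algebra.Polynomial"
begin

text \<open>
  Finite simple undirected graphs are the \<^locale>\<open>pair_graph\<close>s: finite, loop-free, symmetric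
  digraphs whose arcs are pairs of vertices. The null graph is not excluded; it has clique number
  \<open>0\<close> and treewidth \<open>- 1\<close>.
\<close>

definition is_clique :: "'a pair_pre_digraph \<Rightarrow> 'a set \<Rightarrow> bool" where
  "is_clique G S \<longleftrightarrow> S \<subseteq> pverts G \<and> (\<forall>u\<in>S. \<forall>v\<in>S. u \<noteq> v \<longrightarrow> (u, v) \<in> parcs G)"

definition clique_number :: "'a pair_pre_digraph \<Rightarrow> nat" where
  "clique_number G = Max (card ` {S. is_clique G S})"

text \<open>
  \<^const>\<open>tree\<close> is not usable here: in a symmetric digraph it counts \<open>u, v, u\<close> as a cycle, and
  otherwise it only forbids directed cycles. The cycles of an undirected graph are the
  cycles of length at least \<open>3\<close> of the corresponding symmetric digraph.
\<close>

definition undirected_tree :: "'a pair_pre_digraph \<Rightarrow> bool" where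
  "undirected_tree T \<longleftrightarrow> pair_graph T \<and> connected (with_proj T) \<and>
     \<not> (\<exists>c. pre_digraph.cycle (with_proj T) c \<and> 3 \<le> length c)"

definition tree_decomposition ::
    "'a pair_pre_digraph \<Rightarrow> 'b pair_pre_digraph \<Rightarrow> ('b \<Rightarrow> 'a set) \<Rightarrow> bool" where
  "tree_decomposition G T B \<longleftrightarrow> undirected_tree T \<and>
     (\<Union>t\<in>pverts T. B t) = pverts G \<and>
     (\<forall>(u, v)\<in>parcs G. \<exists>t\<in>pverts T. u \<in> B t \<and> v \<in> B t) \<and>
     (\<forall>v\<in>pverts G. connected (with_proj T \<restriction> {t \<in> pverts T. v \<in> B t}))"

definition decomposition_width :: "'b pair_pre_digraph \<Rightarrow> ('b \<Rightarrow> 'a set) \<Rightarrow> int" where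
  "decomposition_width T B = int (Max ((\<lambda>t. card (B t)) ` pverts T)) - 1"

text \<open>
  Decomposition trees are finite, so taking their nodes to be natural numbers is no restriction.
  For a finite graph the infimum is attained: the set of widths is nonempty and bounded below
  by \<open>- 1\<close>.
\<close>

definition treewidth :: "'a pair_pre_digraph \<Rightarrow> int" where
  "treewidth G = Inf {decomposition_width T B |(T :: nat pair_pre_digraph) B.
     tree_decomposition G T B}"

text \<open>
  Every finite graph is isomorphic to one whose vertices are natural numbers, so a graph class is
  an isomorphism-closed set of such graphs.
\<close>

definition graph_class :: "nat pair_pre_digraph set \<Rightarrow> bool" where
  "graph_class \<G> \<longleftrightarrow> (\<forall>G\<in>\<G>. pair_graph G) \<and>
     (\<forall>G\<in>\<G>. \<forall>H. pair_graph H \<and> digraph_iso (with_proj G) (with_proj H) \<longrightarrow> H \<in> \<G>)"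

definition tw_omega_binding :: "(nat \<Rightarrow> real) \<Rightarrow> nat pair_pre_digraph set \<Rightarrow> bool" where
  "tw_omega_binding f \<G> \<longleftrightarrow>
     (\<forall>G\<in>\<G>. \<forall>G'. induced_subgraph (with_proj G') (with_proj G) \<longrightarrow>
        real_of_int (treewidth G') \<le> f (clique_number G'))"

definition polynomially_tw_omega_bounded :: "nat pair_pre_digraph set \<Rightarrow> bool" where
  "polynomially_tw_omega_bounded \<G> \<longleftrightarrow>
     (\<exists>p :: real poly. tw_omega_binding (\<lambda>k. poly p (real k)) \<G>)"

end

theory Submission
  imports Defs
begin

text \<open>
  Polynomial boundedness is a condition on one class at a time, and any class of graphs with at
  most \<open>N\<close> vertices satisfies it trivially: every treewidth occurring there is less than
  \<open>N\<close>, so a constant polynomial is binding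
  (\<open>polynomially_bounded_graphs_of_order_at_most\<close>). Since every finite graph lies in
  such a class, a polynomial \<open>p\<close> that binds all polynomially bounded classes would bind the
  treewidth of every finite graph in terms of its clique number.

  This fails already for clique number \<open>2\<close>: the complete bipartite graph with \<open>n\<close> vertices on
  each side has clique number \<open>2\<close> but treewidth at least \<open>n\<close>, which exceeds \<open>p(2)\<close> for large
  \<open>n\<close>. The lower bound is the inequality between minimum degree and treewidth
  (\<open>min_degree_le_treewidth\<close>). For its proof, consider a leaf \<open>x\<close> of the decomposition tree with
  neighbour \<open>s\<close>. If the bag of \<open>x\<close> is contained in that of \<open>s\<close>, then \<open>x\<close> can be deleted and
  induction applies. Otherwise some vertex \<open>v\<close> lies in the bag of \<open>x\<close> only, and then this bag
  must contain \<open>v\<close> and all its neighbours.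
\<close>

section \<open>Leaves of trees\<close>

text \<open>
  The neighbour \<open>s\<close> of the leaf \<open>x\<close> is an argument because deleting \<open>x\<close> amounts to retracting the
  tree along the edge from \<open>x\<close> to \<open>s\<close>.
\<close>

definition is_leaf :: "'a pair_pre_digraph \<Rightarrow> 'a \<Rightarrow> 'a \<Rightarrow> bool" where
  "is_leaf T x s \<longleftrightarrow> (x, s) \<in> parcs T \<and> (\<forall>y. (x, y) \<in> parcs T \<longrightarrow> y = s)"

definition remove_vertex :: "'a pair_pre_digraph \<Rightarrow> 'a \<Rightarrow> 'a pair_pre_digraph" where
  "remove_vertex T x = \<lparr>pverts = pverts T - {x}, parcs = {e \<in> parcs T. fst e \<noteq> x \<and> snd e \<noteq> x}\<rparr>"

lemma remove_vertex_simps [simp]: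
  "pverts (remove_vertex T x) = pverts T - {x}"
  "parcs (remove_vertex T x) = {e \<in> parcs T. fst e \<noteq> x \<and> snd e \<noteq> x}"
  by (simp_all add: remove_vertex_def)

text \<open>
  The first vertex of a longest path is a leaf: a second neighbour would either extend the path or,
  lying on it, close a cycle.
\<close>

lemma undirected_tree_has_leaf:
  assumes T: "undirected_tree T" and two: "x0 \<in> pverts T" "y0 \<in> pverts T" "x0 \<noteq> y0"
  obtains x s where "is_leaf T x s"
proof -
  interpret T: pair_graph T using T by (simp add: undirected_tree_def)
  define has_path where "has_path = (\<lambda>k. \<exists>u p v. T.apath u p v \<and> length p = k)"
  have bound: "k \<le> card (pverts T)" if "has_path k" for k
    using that T.length_apath by (auto simp: has_path_def)
  have "has_path 0" unfolding has_path_def using two(1) by (metis T.apath_Nil_iff list.size(3))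
  then obtain k where k: "has_path k" and max: "\<And>j. has_path j \<Longrightarrow> j \<le> k"
    using bound by (metis GreatestI_nat Greatest_le_nat)
  \<comment> \<open>An edge exists, so a longest path has a first arc, which supplies the neighbour of the leaf.\<close>
  have "has_path 1"
  proof -
    have "connected (with_proj T)" using T by (simp add: undirected_tree_def)
    then have "x0 \<rightarrow>\<^sup>*\<^bsub>with_proj T\<^esub> y0"
      using T.symmetric_connected_imp_strongly_connected[OF T.sym_arcs] two
      by (auto simp: strongly_connected_def)
    then obtain z where z: "(x0, z) \<in> parcs T"
      using two(3) T.converse_reachable_cases by metis
    then have "T.apath x0 [(x0, z)] z"
      by (auto simp: T.apath_simps T.wellformed' dest: T.no_loops')
    then show ?thesis unfolding has_path_def by force
  qed
  then have "1 \<le> k" by (rule max)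
  then obtain u s p v where p: "T.apath u ((u, s) # p) v" and len: "length p = k - 1"
    using k by (auto simp: has_path_def T.apath_Cons_iff Suc_le_length_iff)
  have us: "(u, s) \<in> parcs T" and sp: "T.awalk s p v" and dist: "distinct (u # pawalk_verts s p)"
    using p by (auto simp: T.apath_def T.awalk_Cons_iff)
  have "w = s" if uw: "(u, w) \<in> parcs T" for w
  proof (rule ccontr)
    assume "w \<noteq> s"
    have wu: "(w, u) \<in> parcs T" using uw by (rule T.arcs_symmetric)
    then have "w \<noteq> u" by (rule T.no_loops')
    show False
    proof (cases "w \<in> set (pawalk_verts s p)")
      case False
      then have "T.apath w ((w, u) # (u, s) # p) v"
        using p wu \<open>w \<noteq> u\<close> by (auto simp: T.apath_Cons_iff)
      then have "has_path (Suc k)" unfolding has_path_def using len \<open>1 \<le> k\<close> by force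
      then show False using max by fastforce
    next
      case True
      then obtain q r where qr: "p = q @ r" "T.awalk s q w"
        using sp T.awalk_decomp by metis
      then have "q \<noteq> []" using \<open>w \<noteq> s\<close> by (auto simp: T.awalk_Nil_iff)
      have "set (pawalk_verts s q) \<subseteq> set (pawalk_verts s p) \<and> distinct (pawalk_verts s q)"
        using dist sp qr by (auto simp: T.awalk_verts_append distinct_append)
      \<comment> \<open>The cycle runs from \<open>w\<close> to \<open>u\<close> and back along the path; \<open>q\<close> is not empty because \<open>w \<noteq> s\<close>.\<close>
      then have "T.cycle ((w, u) # (u, s) # q)"
        using qr(2) wu us dist by (auto simp: T.cycle_def T.awalk_Cons_iff)
      moreover have "3 \<le> length ((w, u) # (u, s) # q)" using \<open>q \<noteq> []\<close> by (cases q) auto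
      ultimately show False using T by (auto simp: undirected_tree_def)
    qed
  qed
  then have "is_leaf T u s" using us unfolding is_leaf_def by blast
  then show thesis by (rule that)
qed

lemma connected_induce_leaf_neighbour:
  assumes T: "pair_graph T" and leaf: "is_leaf T x s"
    and conn: "connected (with_proj T \<restriction> S)" and x: "x \<in> S" and S: "S \<noteq> {x}"
  shows "s \<in> S"
proof -
  interpret T: pair_graph T by fact
  obtain y where y: "y \<in> S" "y \<noteq> x" using x S by blast
  then have "(x, y) \<in> rtrancl_on S ((arcs_ends (with_proj T \<restriction> S))\<^sup>s)"
    using conn x by (auto simp: connected_conv)
  then obtain z where "(x, z) \<in> (arcs_ends (with_proj T \<restriction> S))\<^sup>s"
    using y(2) by (metis converse_rtrancl_on_cases)
  then have "(x, z) \<in> parcs T" "z \<in> S"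
    by (auto simp: symcl_def arcs_ends_conv dest: T.arcs_symmetric)
  then show ?thesis using leaf by (auto simp: is_leaf_def)
qed

text \<open>
  The map that sends \<open>x\<close> to \<open>s\<close> and fixes every other vertex takes each arc to an arc avoiding \<open>x\<close>
  or collapses it to a point. It therefore turns a walk between vertices other than \<open>x\<close> into a walk
  that avoids \<open>x\<close>.
\<close>

lemma connected_induce_minus_leaf:
  assumes T: "pair_graph T" and leaf: "is_leaf T x s"
    and conn: "connected (with_proj T \<restriction> S)" and S: "S \<noteq> {x}"
  shows "connected (with_proj T \<restriction> (S - {x}))"
proof (cases "x \<in> S")
  case False
  then show ?thesis using conn by simp
next
  case True
  interpret T: pair_graph T by fact
  have s: "s \<in> S" "s \<noteq> x"
    using connected_induce_leaf_neighbour[OF T leaf conn True S] leaf T.no_loops'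
    by (auto simp: is_leaf_def)
  let ?r = "\<lambda>z. if z = x then s else z"
  let ?R = "\<lambda>S. (arcs_ends (with_proj T \<restriction> S))\<^sup>s"
  have R: "(a, b) \<in> ?R A \<longleftrightarrow> (a, b) \<in> parcs T \<and> a \<in> A \<and> b \<in> A" for a b A
    by (force simp: symcl_def arcs_ends_conv dest: T.arcs_symmetric)
  have retract: "(?r a, ?r b) \<in> rtrancl_on (S - {x}) (?R (S - {x}))"
    if "(a, b) \<in> rtrancl_on S (?R S)" for a b
    using that
  proof (induction rule: rtrancl_on_induct)
    case base
    then show ?case using s by auto
  next
    case (step y z)
    have yz: "(y, z) \<in> parcs T" "(z, y) \<in> parcs T" using step.hyps T.arcs_symmetric by (auto simp: R)
    show ?case
    proof (cases "y = x \<or> z = x")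
      case True
      then have "?r y = ?r z" using yz leaf by (auto simp: is_leaf_def)
      then show ?thesis using step.IH by simp
    next
      case False
      then have "(?r y, ?r z) \<in> ?R (S - {x})" using step.hyps yz by (simp add: R)
      then show ?thesis using step.IH step.hyps False s
        by (auto intro: rtrancl_on_into_rtrancl_on)
    qed
  qed
  have "(a, b) \<in> rtrancl_on (S - {x}) (?R (S - {x}))" if "a \<in> S - {x}" "b \<in> S - {x}" for a b
    using retract[of a b] that conn by (auto simp: connected_conv)
  then show ?thesis using s by (auto simp: connected_conv)
qed

lemma with_proj_remove_vertex:
  assumes "pair_graph T"
  shows "with_proj (remove_vertex T x) = with_proj T \<restriction> (pverts T - {x})"
proof -
  interpret T: pair_graph T by fact
  show ?thesis
    by (auto simp: with_proj_def induce_subgraph_def T.wellformed')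
qed

lemma induce_remove_vertex:
  "x \<notin> S \<Longrightarrow> with_proj (remove_vertex T x) \<restriction> S = with_proj T \<restriction> S"
  by (auto simp: induce_subgraph_def)

lemma undirected_tree_remove_leaf:
  assumes T: "undirected_tree T" and leaf: "is_leaf T x s"
  shows "undirected_tree (remove_vertex T x)"
proof -
  have pg: "pair_graph T" using T by (simp add: undirected_tree_def)
  interpret T: pair_graph T by (fact pg)
  have s: "s \<in> pverts T" "s \<noteq> x" using leaf by (auto simp: is_leaf_def dest: T.wellformed' T.no_loops')
  have "pair_graph (remove_vertex T x)"
  proof
    show "symmetric (remove_vertex T x)"
      by (auto simp: symmetric_def intro!: symI dest: T.arcs_symmetric)
  qed (use T.no_loops' T.wellformed' in \<open>auto simp: T.pair_finite_verts T.pair_finite_arcs\<close>)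
  moreover have "connected (with_proj (remove_vertex T x))"
  proof -
    have "with_proj T \<restriction> pverts T = with_proj T"
      by (auto simp: with_proj_def induce_subgraph_def T.wellformed')
    then show ?thesis
      using connected_induce_minus_leaf[OF pg leaf, of "pverts T"] T s
      by (auto simp: with_proj_remove_vertex[OF pg] undirected_tree_def)
  qed
  moreover have "\<not> pre_digraph.cycle (with_proj (remove_vertex T x)) c" if "3 \<le> length c" for c
  proof
    assume "pre_digraph.cycle (with_proj (remove_vertex T x)) c"
    moreover have "subgraph (with_proj (remove_vertex T x)) (with_proj T)"
      unfolding with_proj_remove_vertex[OF pg]
      using T.induced_induce[of "pverts T - {x}"] by auto
    ultimately have "T.cycle c" using T.subgraph_cycle by blast
    then show False using T that by (auto simp: undirected_tree_def)
  qed
  ultimately show ?thesis by (auto simp: undirected_tree_def)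
qed

section \<open>Treewidth and minimum degree\<close>

text \<open>
  Induction on the size of the decomposition tree, deleting a leaf whose bag is contained in the bag
  of its neighbour. When this is impossible, some vertex occurs in a single bag, and a bag that alone
  covers all edges at \<open>v\<close> contains \<open>v\<close> and its at least \<open>d\<close> neighbours.
\<close>

lemma tree_decomposition_large_bag:
  assumes G: "pair_graph G" and ne: "pverts G \<noteq> {}"
    and deg: "\<And>v. v \<in> pverts G \<Longrightarrow> d \<le> card {u. (v, u) \<in> parcs G}"
    and TD: "tree_decomposition G T B"
  shows "\<exists>t\<in>pverts T. d < card (B t)"
  using TD
proof (induction "card (pverts T)" arbitrary: T rule: less_induct)
  case less
  interpret G: pair_graph G by fact
  have T: "undirected_tree T" and union: "(\<Union>t\<in>pverts T. B t) = pverts G"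
    and arcs: "\<And>u v. (u, v) \<in> parcs G \<Longrightarrow> \<exists>t\<in>pverts T. u \<in> B t \<and> v \<in> B t"
    and conn: "\<And>v. v \<in> pverts G \<Longrightarrow> connected (with_proj T \<restriction> {t \<in> pverts T. v \<in> B t})"
    using less.prems by (auto simp: tree_decomposition_def)
  have pg: "pair_graph T" using T by (simp add: undirected_tree_def)
  interpret T: pair_graph T by (fact pg)
  have fin: "finite (B t)" if "t \<in> pverts T" for t
    by (rule finite_subset[OF _ G.pair_finite_verts]) (use union that in blast)
  have large: "\<exists>t\<in>pverts T. d < card (B t)"
    if v: "v \<in> pverts G" and x: "{t \<in> pverts T. v \<in> B t} = {x}" for v x
  proof
    show "x \<in> pverts T" using x by auto
    then have "finite (B x)" by (rule fin)
    have "insert v {u. (v, u) \<in> parcs G} \<subseteq> B x" using x arcs by fastforce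
    then have "card (insert v {u. (v, u) \<in> parcs G}) \<le> card (B x)"
      using \<open>finite (B x)\<close> by (intro card_mono)
    moreover have "card (insert v {u. (v, u) \<in> parcs G}) = Suc (card {u. (v, u) \<in> parcs G})"
    proof (rule card_insert_disjoint)
      show "finite {u. (v, u) \<in> parcs G}"
        by (rule finite_subset[OF _ G.pair_finite_verts]) (auto dest: G.wellformed')
    qed (auto dest: G.no_loops')
    ultimately show "d < card (B x)" using deg[OF v] by linarith
  qed
  obtain v0 x0 where v0: "v0 \<in> pverts G" "x0 \<in> pverts T" "v0 \<in> B x0" using ne union by blast
  show ?case
  proof (cases "pverts T = {x0}")
    case True
    then show ?thesis using v0 by (intro large[of v0 x0]) auto
  next
    case False
    then obtain y0 where "y0 \<in> pverts T" "x0 \<noteq> y0" using v0 by blast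
    then obtain x s where leaf: "is_leaf T x s"
      using undirected_tree_has_leaf[OF T v0(2)] by metis
    have xs: "x \<in> pverts T" "s \<in> pverts T" "s \<noteq> x"
      using leaf by (auto simp: is_leaf_def dest: T.wellformed' T.no_loops')
    show ?thesis
    proof (cases "B x \<subseteq> B s")
      case True
      have "tree_decomposition G (remove_vertex T x) B"
        unfolding tree_decomposition_def
      proof (intro conjI ballI)
        show "undirected_tree (remove_vertex T x)"
          by (rule undirected_tree_remove_leaf[OF T leaf])
        show "(\<Union>t\<in>pverts (remove_vertex T x). B t) = pverts G"
          using union True xs by fastforce
        show "case e of (u, v) \<Rightarrow> \<exists>t\<in>pverts (remove_vertex T x). u \<in> B t \<and> v \<in> B t"
          if uv: "e \<in> parcs G" for e
        proof -
          obtain u v where e: "e = (u, v)" by (cases e)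
          then obtain t where "t \<in> pverts T" "u \<in> B t" "v \<in> B t"
            using arcs uv by blast
          then show ?thesis using e True xs by (cases "t = x") auto
        qed
        show "connected (with_proj (remove_vertex T x) \<restriction>
               {t \<in> pverts (remove_vertex T x). v \<in> B t})" if v: "v \<in> pverts G" for v
        proof -
          have "{t \<in> pverts T. v \<in> B t} \<noteq> {x}" using True xs by blast
          moreover have "{t \<in> pverts (remove_vertex T x). v \<in> B t} = {t \<in> pverts T. v \<in> B t} - {x}"
            by auto
          ultimately show ?thesis
            using connected_induce_minus_leaf[OF pg leaf conn[OF v]]
            by (simp add: induce_remove_vertex)
        qed
      qed
      moreover have "card (pverts (remove_vertex T x)) < card (pverts T)"
        using card_Diff1_less[OF T.pair_finite_verts xs(1)] by simp
      ultimately show ?thesis using less.hyps by fastforce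
    next
      case False
      then obtain v where v: "v \<in> B x" "v \<notin> B s" by blast
      then have vG: "v \<in> pverts G" using union xs by blast
      \<comment> \<open>The nodes whose bags contain \<open>v\<close> are connected, and the only way out of \<open>x\<close> is through \<open>s\<close>.\<close>
      then have "{t \<in> pverts T. v \<in> B t} = {x}"
        using connected_induce_leaf_neighbour[OF pg leaf conn[OF vG]] v xs by blast
      then show ?thesis by (rule large[OF vG])
    qed
  qed
qed

lemma single_bag_tree_decomposition:
  assumes "pair_wf_digraph G"
  shows "tree_decomposition G \<lparr>pverts = {t}, parcs = {}\<rparr> (\<lambda>_. pverts G)"
proof -
  interpret G: pair_wf_digraph G by fact
  let ?T = "\<lparr>pverts = {t}, parcs = {}\<rparr>"
  have "pair_graph ?T"
    by unfold_locales (auto simp: symmetric_def intro: symI)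
  moreover have "\<not> pre_digraph.cycle (with_proj ?T) c" for c
    by (auto simp: pre_digraph.cycle_def pre_digraph.awalk_def)
  ultimately have "undirected_tree ?T"
    by (auto simp: undirected_tree_def connected_conv)
  moreover have "connected (with_proj ?T \<restriction> {t})"
    by (auto simp: connected_conv)
  ultimately show ?thesis
    by (auto simp: tree_decomposition_def dest: G.wellformed')
qed

lemma tree_decomposition_tree_finite_nonempty:
  assumes "tree_decomposition G T B"
  shows "finite (pverts T)" "pverts T \<noteq> {}"
  using assms
  by (auto simp: tree_decomposition_def undirected_tree_def connected_conv
      pair_graph_def pair_digraph_def pair_fin_digraph.pair_finite_verts)

lemma treewidth_less_card:
  assumes G: "pair_wf_digraph G"
  shows "treewidth G \<le> int (card (pverts G)) - 1"
  unfolding treewidth_def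
proof (rule cInf_lower)
  show "int (card (pverts G)) - 1 \<in>
    {decomposition_width T B |(T :: nat pair_pre_digraph) B. tree_decomposition G T B}"
    using single_bag_tree_decomposition[OF G, of "0::nat"]
    by (force simp: decomposition_width_def)
  show "bdd_below {decomposition_width T B |(T :: nat pair_pre_digraph) B. tree_decomposition G T B}"
    by (rule bdd_belowI[of _ "-1"]) (auto simp: decomposition_width_def)
qed

lemma min_degree_le_treewidth:
  assumes G: "pair_graph G" and ne: "pverts G \<noteq> {}"
    and deg: "\<And>v. v \<in> pverts G \<Longrightarrow> d \<le> card {u. (v, u) \<in> parcs G}"
  shows "int d \<le> treewidth G"
  unfolding treewidth_def
proof (rule cInf_greatest)
  interpret G: pair_graph G by fact
  show "{decomposition_width T B |(T :: nat pair_pre_digraph) B. tree_decomposition G T B} \<noteq> {}"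
    using single_bag_tree_decomposition[OF G.pair_wf_digraph, of "0::nat"] by blast
next
  fix w assume "w \<in> {decomposition_width T B |(T :: nat pair_pre_digraph) B. tree_decomposition G T B}"
  then obtain T :: "nat pair_pre_digraph" and B
    where w: "w = decomposition_width T B" and TD: "tree_decomposition G T B" by blast
  obtain t where t: "t \<in> pverts T" "d < card (B t)"
    using tree_decomposition_large_bag[OF G ne deg TD] by blast
  then have "card (B t) \<le> Max ((\<lambda>t. card (B t)) ` pverts T)"
    using tree_decomposition_tree_finite_nonempty[OF TD] by (intro Max_ge) auto
  then show "int d \<le> w" using t unfolding w decomposition_width_def by linarith
qed

section \<open>Complete bipartite graphs\<close>

text \<open>
  This is the complete bipartite graph whose sides are the even and the odd numbers below \<open>2 * n\<close>.
\<close>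

definition balanced_bipartite :: "nat \<Rightarrow> nat pair_pre_digraph" where
  "balanced_bipartite n =
     \<lparr>pverts = {..<2 * n}, parcs = {(u, v). u < 2 * n \<and> v < 2 * n \<and> odd (u + v)}\<rparr>"

lemma pair_graph_balanced_bipartite: "pair_graph (balanced_bipartite n)"
proof
  show "finite (parcs (balanced_bipartite n))"
    by (rule finite_subset[of _ "{..<2 * n} \<times> {..<2 * n}"]) (auto simp: balanced_bipartite_def)
qed (auto simp: balanced_bipartite_def symmetric_def intro!: symI)

lemma treewidth_balanced_bipartite:
  assumes "0 < n"
  shows "int n \<le> treewidth (balanced_bipartite n)"
proof (rule min_degree_le_treewidth[OF pair_graph_balanced_bipartite])
  show "pverts (balanced_bipartite n) \<noteq> {}"
    using assms by (simp add: balanced_bipartite_def lessThan_empty_iff)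
  fix v assume v: "v \<in> pverts (balanced_bipartite n)"
  let ?f = "\<lambda>i. if even v then 2 * i + 1 else 2 * i"
  have "card (?f ` {..<n}) = n" by (subst card_image) (auto simp: inj_on_def split: if_splits)
  moreover have "?f ` {..<n} \<subseteq> {u. (v, u) \<in> parcs (balanced_bipartite n)}"
    using v by (auto simp: balanced_bipartite_def)
  moreover have "finite {u. (v, u) \<in> parcs (balanced_bipartite n)}"
    by (auto simp: balanced_bipartite_def)
  ultimately show "n \<le> card {u. (v, u) \<in> parcs (balanced_bipartite n)}" by (metis card_mono)
qed

text \<open>
  The elements of a clique have distinct parities, so there are at most two of them.
\<close>

lemma clique_number_balanced_bipartite:
  assumes "0 < n"
  shows "clique_number (balanced_bipartite n) = 2"
  unfolding clique_number_def
proof (rule Max_eqI)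
  show "finite (card ` {S. is_clique (balanced_bipartite n) S})"
    by (rule finite_imageI, rule finite_subset[of _ "Pow {..<2 * n}"])
      (auto simp: is_clique_def balanced_bipartite_def)
  show "k \<le> 2" if k_size: "k \<in> card ` {S. is_clique (balanced_bipartite n) S}" for k
  proof -
    obtain S where S: "is_clique (balanced_bipartite n) S" and k: "k = card S"
      using k_size by blast
    have "inj_on even S"
    proof (rule inj_onI, rule ccontr)
      fix u v assume uv: "u \<in> S" "v \<in> S" "even u = even v" "u \<noteq> v"
      then have "(u, v) \<in> parcs (balanced_bipartite n)" using S unfolding is_clique_def by blast
      then show False using uv(3) by (simp add: balanced_bipartite_def)
    qed
    then have "card S \<le> card (UNIV :: bool set)" by (rule card_inj_on_le) auto
    then show ?thesis by (simp add: k)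
  qed
  have "is_clique (balanced_bipartite n) {0, 1}"
    using assms by (auto simp: is_clique_def balanced_bipartite_def)
  then show "2 \<in> card ` {S. is_clique (balanced_bipartite n) S}"
    by (intro image_eqI[where x = "{0, 1}"]) simp_all
qed

section \<open>Classes of graphs of bounded order\<close>

definition graphs_of_order_at_most :: "nat \<Rightarrow> nat pair_pre_digraph set" where
  "graphs_of_order_at_most N = {G. pair_graph G \<and> card (pverts G) \<le> N}"

lemma graph_class_graphs_of_order_at_most: "graph_class (graphs_of_order_at_most N)"
  unfolding graph_class_def
proof (intro conjI ballI allI impI)
  fix G H :: "nat pair_pre_digraph"
  assume G: "G \<in> graphs_of_order_at_most N"
    and H: "pair_graph H \<and> digraph_iso (with_proj G) (with_proj H)"
  then obtain f where "with_proj H = app_iso f (with_proj G)"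
    by (auto simp: digraph_iso_def)
  then have "pverts H = iso_verts f ` pverts G"
    by (metis verts_app_iso with_proj_simps(1))
  then have "card (pverts H) \<le> card (pverts G)"
    using G by (auto simp: graphs_of_order_at_most_def pair_graph_def pair_digraph_def
        pair_fin_digraph.pair_finite_verts intro: card_image_le)
  then show "H \<in> graphs_of_order_at_most N"
    using G H by (simp add: graphs_of_order_at_most_def)
qed (simp add: graphs_of_order_at_most_def)

lemma polynomially_bounded_graphs_of_order_at_most:
  "polynomially_tw_omega_bounded (graphs_of_order_at_most N)"
  unfolding polynomially_tw_omega_bounded_def tw_omega_binding_def
proof (intro exI[of _ "[:real N:]"] ballI allI impI)
  fix G G' :: "nat pair_pre_digraph"
  assume G: "G \<in> graphs_of_order_at_most N"
    and sub: "induced_subgraph (with_proj G') (with_proj G)"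
  have "pair_wf_digraph G'" "pverts G' \<subseteq> pverts G"
    using sub by (auto simp: induced_subgraph_def subgraph_def wf_digraph_wp_iff)
  moreover have "finite (pverts G)"
    using G by (auto simp: graphs_of_order_at_most_def pair_graph_def pair_digraph_def
        pair_fin_digraph.pair_finite_verts)
  ultimately have "treewidth G' \<le> int N"
    using treewidth_less_card[of G'] card_mono[of "pverts G" "pverts G'"] G
    by (auto simp: graphs_of_order_at_most_def)
  then show "real_of_int (treewidth G') \<le> poly [:real N:] (real (clique_number G'))" by simp
qed

theorem corollary7p3:
  shows "\<not> (\<exists>p :: real poly. \<forall>\<G>. graph_class \<G> \<and> polynomially_tw_omega_bounded \<G> \<longrightarrow>
           tw_omega_binding (\<lambda>k. poly p (real k)) \<G>)"
proof
  assume "\<exists>p :: real poly. \<forall>\<G>. graph_class \<G> \<and> polynomially_tw_omega_bounded \<G> \<longrightarrow>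
           tw_omega_binding (\<lambda>k. poly p (real k)) \<G>"
  then obtain p :: "real poly" where p: "\<And>\<G>. graph_class \<G> \<Longrightarrow>
      polynomially_tw_omega_bounded \<G> \<Longrightarrow> tw_omega_binding (\<lambda>k. poly p (real k)) \<G>"
    by blast
  obtain n :: nat where "max 0 (poly p 2) < real n" using reals_Archimedean2 by blast
  then have n: "0 < n" "poly p 2 < real n" by auto
  let ?K = "balanced_bipartite n"
  interpret K: pair_graph ?K by (rule pair_graph_balanced_bipartite)
  have "?K \<in> graphs_of_order_at_most (2 * n)"
    using pair_graph_balanced_bipartite
    by (simp add: graphs_of_order_at_most_def) (simp add: balanced_bipartite_def)
  moreover have "induced_subgraph (with_proj ?K) (with_proj ?K)" by (rule K.induced_subgraph_refl)
  ultimately have "real_of_int (treewidth ?K) \<le> poly p (real (clique_number ?K))"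
    using p[OF graph_class_graphs_of_order_at_most polynomially_bounded_graphs_of_order_at_most]
    unfolding tw_omega_binding_def by blast
  then have "real_of_int (treewidth ?K) \<le> poly p 2"
    using clique_number_balanced_bipartite[OF n(1)] by simp
  then show False using treewidth_balanced_bipartite[OF n(1)] n(2) by linarith
qed

end
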